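(* Let $(G,\bullet)$ be a finite Abelian group, let $H$ be a $d$-dimensional Hilbert space, and let $X=\{x_g\}_{g\in G}$ be a tight frame for $H$. Then $G$ defines a frame multiplication for $X$ if and only if $X$ is a group frame.
   Context: Hilbert spaces are over $\mathbb{F}=\mathbb{R}$ or $\mathbb{C}$. A sequence $X=\{x_j\}_{j\in J}$ (repetitions allowed) in a Hilbert space $H$ is a tight frame for $H$ if there is $A>0$ such that $\sum_{j\in J}|\langle x,x_j\rangle|^2=A\|x\|^2$ for all $x\in H$. Given a frame $X=\{x_g\}_{g\in G}$ for $H$ indexed by a group $(G,\bullet)$, we say that $G$ defines a frame multiplication for $X$ if there exists a bilinear product $\ast:H\times H\to H$ such that $x_g\ast x_h=x_{g\bullet h}$ for all $g,h\in G$. Let $\mathcal{U}(H)$ be the group of unitary operators on $H$. A tight frame $X=\{x_g\}_{g\in G}$ for $H$, indexed by a finite group $(G,\bullet)$, is a group frame if there exists a unitary representation (group homomorphism) $\pi:G\to\mathcal{U}(H)$ such that $\pi(g)x_h=x_{g\bullet h}$ for all $g,h\in G$. *)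

theory Defs
  imports
    "HOL-Algebra.Group"
    "HOL-Analysis.Infinite_Sum"
    "HOL-Library.Nonpos_Ints"
    "Jordan_Normal_Form.Conjugate"
begin

(* The scalar fields R and C. The axiom ties the abstract conjugation to the absolute value; by the
   Gelfand-Mazur theorem, R with the identity and C with complex conjugation are, up to isomorphism,
   the only models. *)
class real_or_complex = real_normed_field + conjugatable_field +
  assumes mult_conjugate: "x * conjugate x = (norm x)\<^sup>2 *\<^sub>R 1"

instance real :: real_or_complex
  by standard (simp add: power2_eq_square)

instance complex :: real_or_complex
  by standard (simp add: complex_norm_square[symmetric] scaleR_conv_of_real del: of_real_power)

(* Linear in the first argument. The whole type of vectors is the space, so that its zero-dimensional
   case (a one-element type) is not excluded. *)
locale inner_product_space = vector_space sc
  for sc :: "'k::real_or_complex \<Rightarrow> 'h::ab_group_add \<Rightarrow> 'h" +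
  fixes ip :: "'h \<Rightarrow> 'h \<Rightarrow> 'k"
  assumes ip_add_left: "ip (u + v) w = ip u w + ip v w"
    and ip_scale_left: "ip (sc c u) w = c * ip u w"
    and ip_conjugate: "ip w u = conjugate (ip u w)"
    and ip_nonneg: "ip u u \<in> \<real>\<^sub>\<ge>\<^sub>0"
    and ip_definite: "ip u u = 0 \<Longrightarrow> u = 0"

(* ip u u is a nonnegative real element of the scalar field; the outer norm maps it to type real. *)
definition ip_norm :: "('h \<Rightarrow> 'h \<Rightarrow> 'k::real_or_complex) \<Rightarrow> 'h \<Rightarrow> real" where
  "ip_norm ip u = sqrt (norm (ip u u))"

locale hilbert_space = inner_product_space sc ip
  for sc :: "'k::real_or_complex \<Rightarrow> 'h::ab_group_add \<Rightarrow> 'h" and ip +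
  assumes complete:
    "\<And>u :: nat \<Rightarrow> 'h. (\<And>e. e > 0 \<Longrightarrow> \<exists>N. \<forall>m\<ge>N. \<forall>n\<ge>N. ip_norm ip (u m - u n) < e)
      \<Longrightarrow> \<exists>l. (\<lambda>n. ip_norm ip (u n - l)) \<longlonglongrightarrow> 0"

(* Not "dim UNIV = d", which for d = 0 would also hold in infinite dimension. *)
definition has_dimension :: "('k::field \<Rightarrow> 'h::ab_group_add \<Rightarrow> 'h) \<Rightarrow> nat \<Rightarrow> bool" where
  "has_dimension sc d \<longleftrightarrow>
    (\<exists>B. finite B \<and> card B = d \<and> \<not> module.dependent sc B \<and> module.span sc B = UNIV)"

definition tight_frame ::
  "('h \<Rightarrow> 'h \<Rightarrow> 'k::real_or_complex) \<Rightarrow> 'j set \<Rightarrow> ('j \<Rightarrow> 'h) \<Rightarrow> bool" where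
  "tight_frame ip J x \<longleftrightarrow>
    (\<exists>A>0. \<forall>v. ((\<lambda>j. (norm (ip v (x j)))\<^sup>2) has_sum A * (ip_norm ip v)\<^sup>2) J)"

definition defines_frame_multiplication ::
  "('k::field \<Rightarrow> 'h::ab_group_add \<Rightarrow> 'h) \<Rightarrow> ('g, 'm) monoid_scheme \<Rightarrow> ('g \<Rightarrow> 'h) \<Rightarrow> bool" where
  "defines_frame_multiplication sc G x \<longleftrightarrow>
    (\<exists>p :: 'h \<Rightarrow> 'h \<Rightarrow> 'h.
      (\<forall>u. Vector_Spaces.linear sc sc (\<lambda>v. p u v)) \<and>
      (\<forall>v. Vector_Spaces.linear sc sc (\<lambda>u. p u v)) \<and>
      (\<forall>g\<in>carrier G. \<forall>h\<in>carrier G. p (x g) (x h) = x (g \<otimes>\<^bsub>G\<^esub> h)))"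

definition unitary_group ::
  "('k::real_or_complex \<Rightarrow> 'h::ab_group_add \<Rightarrow> 'h) \<Rightarrow> ('h \<Rightarrow> 'h \<Rightarrow> 'k) \<Rightarrow> ('h \<Rightarrow> 'h) monoid" where
  "unitary_group sc ip =
    \<lparr>carrier = {U. Vector_Spaces.linear sc sc U \<and> bij U \<and> (\<forall>u v. ip (U u) (U v) = ip u v)},
     monoid.mult = (\<circ>), one = id\<rparr>"

definition group_frame ::
  "('k::real_or_complex \<Rightarrow> 'h::ab_group_add \<Rightarrow> 'h) \<Rightarrow> ('h \<Rightarrow> 'h \<Rightarrow> 'k) \<Rightarrow>
    ('g, 'm) monoid_scheme \<Rightarrow> ('g \<Rightarrow> 'h) \<Rightarrow> bool" where
  "group_frame sc ip G x \<longleftrightarrow>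
    group G \<and> finite (carrier G) \<and> tight_frame ip (carrier G) x \<and>
    (\<exists>\<pi> \<in> hom G (unitary_group sc ip).
      \<forall>g\<in>carrier G. \<forall>h\<in>carrier G. \<pi> g (x h) = x (g \<otimes>\<^bsub>G\<^esub> h))"

lemma (in inner_product_space) group_unitary_group: "group (unitary_group sc ip)"
proof (rule groupI)
  fix U assume U: "U \<in> carrier (unitary_group sc ip)"
  then have lin: "Vector_Spaces.linear sc sc U" and bij: "bij U"
    and ip: "\<And>u v. ip (U u) (U v) = ip u v"
    by (auto simp: unitary_group_def)
  interpret U: Vector_Spaces.linear sc sc U by (fact lin)
  define V where "V = inv_into UNIV U"
  have f: "U (V u) = u" for u using bij by (simp add: V_def bij_is_surj surj_f_inv_f)
  have g: "V (U u) = u" for u using bij by (simp add: V_def bij_is_inj)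
  have "Vector_Spaces.linear sc sc (V)"
  proof unfold_locales
    show "V (u + v) = V u + V v" for u v
      by (metis U.add f g)
    show "V (sc c u) = sc c (V u)" for c u
      by (metis U.scale f g)
  qed
  moreover have "ip (V u) (V v) = ip u v" for u v
    using ip[of "V u" "V v"] by (simp add: f)
  ultimately have "V \<in> carrier (unitary_group sc ip)"
    using bij by (simp add: unitary_group_def V_def bij_imp_bij_inv)
  moreover have "V \<otimes>\<^bsub>unitary_group sc ip\<^esub> U = \<one>\<^bsub>unitary_group sc ip\<^esub>"
    by (simp add: unitary_group_def fun_eq_iff g)
  ultimately show "\<exists>V\<in>carrier (unitary_group sc ip).
      V \<otimes>\<^bsub>unitary_group sc ip\<^esub> U = \<one>\<^bsub>unitary_group sc ip\<^esub>"
    by blast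
qed (auto simp: unitary_group_def linear_id[unfolded id_def] id_def bij_comp comp_assoc
      intro: Vector_Spaces.linear_compose bij_id[unfolded id_def])

end

(* A tight frame with bound A satisfies the reconstruction formula A v = sum_j <v, x_j> x_j, so
   linear maps are determined by their values on the frame. A frame multiplication * yields the
   representation v |-> x_g * v; it is unitary because, by reconstruction, the adjoint of
   multiplication by x_g is multiplication by x_(g^-1). Conversely, a representation pi with
   pi(g) x_h = x_(gh) yields the product u * v = (1/A) sum_g <u, x_g> pi(g) v; commutativity
   turns x_h * x_k into pi(k) applied to the reconstruction of x_h. *)

theory Submission
  imports Defs
begin

text \<open>The class axiom gives \<open>r * conjugate r = r * r\<close> for real \<open>r\<close>,
  and a nonzero \<open>r\<close> cancels.\<close>

lemma conjugate_of_real: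
  "conjugate (of_real r :: 'k::real_or_complex) = of_real r"
proof (cases "r = 0")
  case False
  have "of_real r * conjugate (of_real r :: 'k) = of_real r * of_real r"
    by (simp add: mult_conjugate of_real_def power2_eq_square)
  with False show ?thesis by simp
qed simp

context inner_product_space
begin

lemma ip_add_right: "ip w (u + v) = ip w u + ip w v"
  by (metis ip_conjugate ip_add_left conjugate_dist_add)

lemma ip_scale_right: "ip w (sc c u) = conjugate c * ip w u"
  by (metis ip_conjugate ip_scale_left conjugate_dist_mul)

lemma ip_zero_left [simp]: "ip 0 w = 0"
  using ip_add_left[of 0 0 w] by simp

lemma ip_zero_right [simp]: "ip w 0 = 0"
  using ip_add_right[of w 0 0] by simp

lemma ip_sum_left: "ip (\<Sum>i\<in>I. f i) w = (\<Sum>i\<in>I. ip (f i) w)"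
  by (induction I rule: infinite_finite_induct) (simp_all add: ip_add_left)

lemma ip_sum_right: "ip w (\<Sum>i\<in>I. f i) = (\<Sum>i\<in>I. ip w (f i))"
  by (induction I rule: infinite_finite_induct) (simp_all add: ip_add_right)

lemma ip_diff_left: "ip (u - v) w = ip u w - ip v w"
  using ip_add_left[of "u - v" v w] by simp

lemma ip_diff_right: "ip w (u - v) = ip w u - ip w v"
  using ip_add_right[of w "u - v" v] by simp

text \<open>Together with \<open>of_real_norm_ip_sq\<close>, this lifts the real-valued tightness
  identity to the scalar field, where sesquilinearity can be used.\<close>

lemma of_real_ip_norm_sq: "of_real ((ip_norm ip v)\<^sup>2) = ip v v"
proof -
  obtain r where "ip v v = of_real r" "r \<ge> 0"
    using ip_nonneg[of v] by (auto elim: nonneg_Reals_cases)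
  then show ?thesis by (simp add: ip_norm_def)
qed

lemma of_real_norm_ip_sq: "of_real ((norm (ip v w))\<^sup>2) = ip v w * ip w v"
  by (metis ip_conjugate mult_conjugate of_real_def)

end

locale finite_tight_frame = inner_product_space sc ip
  for sc :: "'k::real_or_complex \<Rightarrow> 'h::ab_group_add \<Rightarrow> 'h" and ip +
  fixes J :: "'j set" and x :: "'j \<Rightarrow> 'h" and A :: real
  assumes fin: "finite J" and A_pos: "A > 0"
    and tight: "(\<Sum>j\<in>J. (norm (ip v (x j)))\<^sup>2) = A * (ip_norm ip v)\<^sup>2"
begin

text \<open>The defect \<open>S\<close>, the frame operator minus \<open>A\<close> times the
  identity, is self-adjoint, and tightness says that its quadratic form vanishes. Such an operator
  is zero.\<close>

lemma frame_operator: "(\<Sum>j\<in>J. sc (ip v (x j)) (x j)) = sc (of_real A) v"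
proof -
  define S where "S v = (\<Sum>j\<in>J. sc (ip v (x j)) (x j)) - sc (of_real A) v" for v
  have S_ip: "ip (S u) w = (\<Sum>j\<in>J. ip u (x j) * ip (x j) w) - of_real A * ip u w" for u w
    by (simp add: S_def ip_diff_left ip_sum_left ip_scale_left)
  have S_selfadjoint: "ip u (S w) = ip (S u) w" for u w
    unfolding S_ip
    by (simp add: S_def ip_diff_right ip_sum_right ip_scale_right conjugate_of_real
        flip: ip_conjugate) (simp add: mult.commute)
  have S_diag: "ip (S u) u = 0" for u
  proof -
    have "(\<Sum>j\<in>J. ip u (x j) * ip (x j) u) = of_real (\<Sum>j\<in>J. (norm (ip u (x j)))\<^sup>2)"
      by (simp only: of_real_sum of_real_norm_ip_sq)
    also have "\<dots> = of_real A * ip u u"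
      by (simp only: tight of_real_mult of_real_ip_norm_sq)
    finally show ?thesis by (simp add: S_ip)
  qed
  have S_add: "ip (S (u + w)) z = ip (S u) z + ip (S w) z" for u w z
    by (simp add: S_ip ip_add_left algebra_simps sum.distrib)
  \<comment> \<open>polarisation along \<open>v\<close> and \<open>S v\<close>, which needs no imaginary unit since \<open>S\<close> is self-adjoint\<close>
  have "ip (S v) (S v) + ip (S (S v)) v = 0"
    using S_diag[of "v + S v"] S_diag[of v] S_diag[of "S v"] by (simp add: S_add ip_add_right add.commute)
  then have "2 * ip (S v) (S v) = 0"
    using S_selfadjoint[of "S v" v] by simp
  then have "S v = 0" by (auto intro: ip_definite)
  then show ?thesis by (simp add: S_def)
qed

lemma reconstruction: "v = (\<Sum>j\<in>J. sc (ip v (x j) / of_real A) (x j))"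
proof -
  have "v = sc (1 / of_real A) (sc (of_real A) v)"
    using A_pos by simp
  also have "\<dots> = (\<Sum>j\<in>J. sc (ip v (x j) / of_real A) (x j))"
    by (simp add: scale_sum_right flip: frame_operator)
  finally show ?thesis .
qed

lemma linear_expansion:
  assumes "Vector_Spaces.linear sc sc f"
  shows "f v = (\<Sum>j\<in>J. sc (ip v (x j) / of_real A) (f (x j)))"
proof -
  interpret f: Vector_Spaces.linear sc sc f by fact
  show ?thesis by (subst reconstruction[of v]) (simp add: f.sum f.scale)
qed

text \<open>The coefficients in \<open>linear_expansion\<close> depend on \<open>v\<close> alone and
  not on the map. The frame vectors thus determine a linear map even when they are linearly
  dependent.\<close>

lemma linear_eqI:
  assumes "Vector_Spaces.linear sc sc f" "Vector_Spaces.linear sc sc f'"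
    and "\<And>j. j \<in> J \<Longrightarrow> f (x j) = f' (x j)"
  shows "f = f'"
proof
  show "f v = f' v" for v
    unfolding linear_expansion[OF assms(1), of v] linear_expansion[OF assms(2), of v]
    by (simp add: assms(3))
qed

end

locale group_tight_frame = finite_tight_frame sc ip "carrier G" x A + G?: group G
  for sc :: "'k::real_or_complex \<Rightarrow> 'h::ab_group_add \<Rightarrow> 'h" and ip
    and G :: "('g, 'm) monoid_scheme" (structure) and x :: "'g \<Rightarrow> 'h" and A
begin

lemma inverse_translation:
  assumes lin: "Vector_Spaces.linear sc sc U" "Vector_Spaces.linear sc sc V"
    and g: "g \<in> carrier G"
    and U: "\<And>h. h \<in> carrier G \<Longrightarrow> U (x h) = x (g \<otimes> h)"
    and V: "\<And>h. h \<in> carrier G \<Longrightarrow> V (x h) = x (inv g \<otimes> h)"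
  shows "V \<circ> U = id"
proof (rule linear_eqI)
  show "Vector_Spaces.linear sc sc (V \<circ> U)"
    using lin by (rule Vector_Spaces.linear_compose)
  show "Vector_Spaces.linear sc sc id" by (rule linear_id)
  show "(V \<circ> U) (x h) = id (x h)" if "h \<in> carrier G" for h
    using that g by (simp add: U V flip: m_assoc)
qed

text \<open>\<open>V\<close> is a two-sided inverse of \<open>U\<close> by
  \<open>inverse_translation\<close>, and reconstruction shows that it is also the adjoint of
  \<open>U\<close>.\<close>

lemma translation_unitary:
  assumes lin: "Vector_Spaces.linear sc sc U" "Vector_Spaces.linear sc sc V"
    and g: "g \<in> carrier G"
    and U: "\<And>h. h \<in> carrier G \<Longrightarrow> U (x h) = x (g \<otimes> h)"
    and V: "\<And>h. h \<in> carrier G \<Longrightarrow> V (x h) = x (inv g \<otimes> h)"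
  shows "U \<in> carrier (unitary_group sc ip)"
proof -
  have VU: "V (U v) = v" for v
    using inverse_translation[OF lin g U V] by (metis comp_apply id_apply)
  \<comment> \<open>The same lemma with \<open>U\<close> and \<open>V\<close> exchanged and
    \<open>inv g\<close> in place of \<open>g\<close>.\<close>
  have UV: "U (V v) = v" for v
    using inverse_translation[OF lin(2,1) inv_closed[OF g] V] g U by (simp add: fun_eq_iff)
  have V_adjoint: "ip (V v) w = ip v (U w)" for v w
  proof -
    have "V v = V (\<Sum>j\<in>carrier G. sc (ip v (x j) / of_real A) (x j))"
      by (simp flip: reconstruction)
    \<comment> \<open>Substituting \<open>j = g \<otimes> h\<close> turns every frame vector into
      some \<open>U (x h)\<close>, so that \<open>U\<close> can be pulled out of the sum and
      cancelled by \<open>V\<close>.\<close>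
    also have "(\<Sum>j\<in>carrier G. sc (ip v (x j) / of_real A) (x j)) =
        (\<Sum>h\<in>carrier G. sc (ip v (x (g \<otimes> h)) / of_real A) (x (g \<otimes> h)))"
      using g by (intro sum.reindex_bij_witness[of _ "\<lambda>h. g \<otimes> h" "\<lambda>j. inv g \<otimes> j"])
        (auto simp flip: m_assoc)
    also have "\<dots> = U (\<Sum>h\<in>carrier G. sc (ip v (x (g \<otimes> h)) / of_real A) (x h))"
    proof -
      interpret U: Vector_Spaces.linear sc sc U by fact
      show ?thesis by (simp add: U.sum U.scale U)
    qed
    finally have V_eq: "V v = (\<Sum>h\<in>carrier G. sc (ip v (x (g \<otimes> h)) / of_real A) (x h))"
      by (simp add: VU)
    have "conjugate (1 / of_real A :: 'k) = 1 / of_real A"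
      by (metis conjugate_of_real of_real_1 of_real_divide)
    then have "conjugate (c / of_real A) = conjugate c / of_real A" for c :: 'k
      using conjugate_dist_mul[of c "1 / of_real A"] by simp
    \<comment> \<open>Here \<open>w\<close> is expanded instead of \<open>v\<close>; conjugation
      turns its coefficients into \<open>ip (x h) w\<close>, and the sum agrees termwise with
      \<open>V_eq\<close> paired with \<open>w\<close>.\<close>
    then have "ip v (U w) = (\<Sum>h\<in>carrier G. ip (x h) w / of_real A * ip v (x (g \<otimes> h)))"
      by (simp add: linear_expansion[OF lin(1), of w] U ip_sum_right ip_scale_right
          flip: ip_conjugate)
    then show ?thesis
      by (simp add: V_eq ip_sum_left ip_scale_left mult.commute)
  qed
  have "ip (U u) (U v) = ip u v" for u v
    by (simp add: VU flip: V_adjoint)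
  moreover have "bij U"
    using VU UV by (intro o_bij[of V]) (auto simp: fun_eq_iff)
  ultimately show ?thesis using lin by (simp add: unitary_group_def)
qed

lemma representation_of_frame_multiplication:
  assumes "defines_frame_multiplication sc G x"
  shows "\<exists>\<pi> \<in> hom G (unitary_group sc ip).
      \<forall>g\<in>carrier G. \<forall>h\<in>carrier G. \<pi> g (x h) = x (g \<otimes> h)"
proof -
  obtain p where lin: "\<And>u. Vector_Spaces.linear sc sc (p u)"
    and p: "\<And>g h. g \<in> carrier G \<Longrightarrow> h \<in> carrier G \<Longrightarrow> p (x g) (x h) = x (g \<otimes> h)"
    using assms unfolding defines_frame_multiplication_def by blast
  have "p (x g) \<in> carrier (unitary_group sc ip)" if "g \<in> carrier G" for g
    using that by (intro translation_unitary[OF lin[of "x g"] lin[of "x (inv g)"]]) (auto simp: p)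
  \<comment> \<open>The product \<open>p\<close> is not assumed associative; associativity of
    \<open>G\<close> makes both linear maps agree on the frame, hence everywhere.\<close>
  moreover have "p (x (g \<otimes> h)) = p (x g) \<circ> p (x h)"
    if "g \<in> carrier G" "h \<in> carrier G" for g h
    using that
    by (intro linear_eqI lin Vector_Spaces.linear_compose[OF lin lin]) (auto simp: p m_assoc)
  ultimately have "(\<lambda>g. p (x g)) \<in> hom G (unitary_group sc ip)"
    by (intro homI) (auto simp: unitary_group_def)
  then show ?thesis by (rule rev_bexI) (simp add: p)
qed

end

locale comm_group_tight_frame = group_tight_frame sc ip G x A + G?: comm_group G
  for sc :: "'k::real_or_complex \<Rightarrow> 'h::ab_group_add \<Rightarrow> 'h" and ip
    and G :: "('g, 'm) monoid_scheme" (structure) and x :: "'g \<Rightarrow> 'h" and A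
begin

lemma frame_multiplication_of_translations:
  assumes lin: "\<And>g. g \<in> carrier G \<Longrightarrow> Vector_Spaces.linear sc sc (\<pi> g)"
    and \<pi>: "\<And>g h. g \<in> carrier G \<Longrightarrow> h \<in> carrier G \<Longrightarrow> \<pi> g (x h) = x (g \<otimes> h)"
  shows "defines_frame_multiplication sc G x"
proof -
  \<comment> \<open>The frame may be linearly dependent, so prescribing \<open>\<pi> g\<close> at
    \<open>x g\<close> need not extend linearly in \<open>u\<close>. The canonical coefficients of
    \<open>u\<close> are linear in \<open>u\<close> and avoid the choice of an expansion.\<close>
  define p where "p u v = (\<Sum>g\<in>carrier G. sc (ip u (x g) / of_real A) (\<pi> g v))" for u v
  have add: "\<pi> g (u + v) = \<pi> g u + \<pi> g v" if "g \<in> carrier G" for g u v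
    using lin[OF that] by (simp add: Vector_Spaces.linear_iff)
  have scale: "\<pi> g (sc c v) = sc c (\<pi> g v)" if "g \<in> carrier G" for g c v
    using lin[OF that] by (simp add: Vector_Spaces.linear_iff)
  have "Vector_Spaces.linear sc sc (p u)" for u
    by unfold_locales
      (auto simp: p_def add scale scale_right_distrib sum.distrib scale_sum_right mult.commute)
  moreover have "Vector_Spaces.linear sc sc (\<lambda>u. p u v)" for v
    by unfold_locales
      (auto simp: p_def ip_add_left ip_scale_left add_divide_distrib scale_left_distrib
        sum.distrib scale_sum_right)
  moreover have "p (x h) (x k) = x (h \<otimes> k)" if "h \<in> carrier G" "k \<in> carrier G" for h k
  proof -
    \<comment> \<open>By commutativity \<open>\<pi> g (x k) = \<pi> k (x g)\<close>, so a single map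
      \<open>\<pi> k\<close> acts on the reconstruction of \<open>x h\<close>.\<close>
    have "p (x h) (x k) = (\<Sum>g\<in>carrier G. sc (ip (x h) (x g) / of_real A) (\<pi> k (x g)))"
      unfolding p_def using that by (intro sum.cong) (simp_all add: \<pi> m_comm)
    also have "\<dots> = \<pi> k (x h)"
      by (rule linear_expansion[OF lin[OF that(2)], symmetric])
    finally show ?thesis using that by (simp add: \<pi> m_comm)
  qed
  ultimately show ?thesis unfolding defines_frame_multiplication_def by blast
qed

end

theorem theorem7p3:
  fixes sc :: "'k::real_or_complex \<Rightarrow> 'h::ab_group_add \<Rightarrow> 'h"
    and ip :: "'h \<Rightarrow> 'h \<Rightarrow> 'k"
    and d :: nat
    and G :: "('g, 'm) monoid_scheme"
    and x :: "'g \<Rightarrow> 'h"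
  assumes "comm_group G" and "finite (carrier G)"
    and "hilbert_space sc ip" and "has_dimension sc d"
    and "tight_frame ip (carrier G) x"
  shows "defines_frame_multiplication sc G x \<longleftrightarrow> group_frame sc ip G x"
proof -
  interpret hilbert_space sc ip by fact
  interpret comm_group G by fact
  obtain A where "A > 0"
    and A: "\<And>v. ((\<lambda>j. (norm (ip v (x j)))\<^sup>2) has_sum A * (ip_norm ip v)\<^sup>2) (carrier G)"
    using assms(5) unfolding tight_frame_def by blast
  interpret comm_group_tight_frame sc ip G x A
  proof unfold_locales
    \<comment> \<open>Over a finite index set \<open>has_sum\<close> holds for the ordinary sum, and
      its value is unique.\<close>
    show "(\<Sum>j\<in>carrier G. (norm (ip v (x j)))\<^sup>2) = A * (ip_norm ip v)\<^sup>2" for v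
      using has_sum_unique[OF has_sum_finite[OF assms(2)] A] .
  qed fact+
  show ?thesis
  proof
    assume "defines_frame_multiplication sc G x"
    then show "group_frame sc ip G x"
      using representation_of_frame_multiplication is_group assms(2,5)
      by (simp add: group_frame_def)
  next
    assume "group_frame sc ip G x"
    then obtain \<pi> where "\<pi> \<in> hom G (unitary_group sc ip)"
      and \<pi>: "\<And>g h. g \<in> carrier G \<Longrightarrow> h \<in> carrier G \<Longrightarrow> \<pi> g (x h) = x (g \<otimes>\<^bsub>G\<^esub> h)"
      unfolding group_frame_def by blast
    then have "Vector_Spaces.linear sc sc (\<pi> g)" if "g \<in> carrier G" for g
      using that by (auto simp: hom_def unitary_group_def Pi_iff)
    then show "defines_frame_multiplication sc G x"
      using \<pi> by (rule frame_multiplication_of_translations)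
  qed
qed

end
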